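(* Let $\nu$ be a non-degenerate compactly supported probability measure on $\mathbb{R}$ such that $0\in\Theta=(\theta_-,\theta_+)$ and $m_0(\nu)=\int x\,\nu(dx)=0$. Denote by $(T_n)_{n\in\mathbb{N}}$ the sequence of orthogonal polynomials with respect to $\nu$ such that $T_n$ is monic of degree $n$. Let $r=\sup\{\alpha : (-\alpha,\alpha)\subset\Theta\}$. Then the power series $\sum_{n} z^nT_n(x)$, with values in $L^2(\nu)$, has radius of convergence $\geq r$.
   Context: For a non-degenerate (not a point mass) compactly supported probability measure $\nu$ on $\mathbb{R}$, put $B=\max\{0,\sup\operatorname{supp}\nu\}$ and $A=\min\{0,\inf\operatorname{supp}\nu\}$, and let $\theta_+=1/B$ (interpreted as $+\infty$ if $B=0$) and $\theta_-=1/A$ (interpreted as $-\infty$ if $A=0$). Then $\Theta=(\theta_-,\theta_+)$ is the natural domain of $M_\nu(\theta)=\int\frac{1}{1-\theta x}\,\nu(dx)$. Orthogonality of $(T_n)$ with respect to $\nu$ means $\int T_nT_k\,d\nu=0$ for all $n\neq k$. *)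

theory Defs
  imports "HOL-Probability.Probability" "HOL-Computational_Algebra.Polynomial"
begin

definition msupp :: "real measure \<Rightarrow> real set" where
  "msupp \<nu> = {x. \<forall>U. open U \<longrightarrow> x \<in> U \<longrightarrow> emeasure \<nu> U > 0}"

definition non_degenerate :: "real measure \<Rightarrow> bool" where
  "non_degenerate \<nu> \<longleftrightarrow> (\<nexists>a. \<nu> = return borel a)"

definition upper_end :: "real measure \<Rightarrow> real" where
  "upper_end \<nu> = max 0 (Sup (msupp \<nu>))"

definition lower_end :: "real measure \<Rightarrow> real" where
  "lower_end \<nu> = min 0 (Inf (msupp \<nu>))"

definition theta_plus :: "real measure \<Rightarrow> ereal" where
  "theta_plus \<nu> = (if upper_end \<nu> = 0 then \<infinity> else ereal (1 / upper_end \<nu>))"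

definition theta_minus :: "real measure \<Rightarrow> ereal" where
  "theta_minus \<nu> = (if lower_end \<nu> = 0 then - \<infinity> else ereal (1 / lower_end \<nu>))"

definition Theta :: "real measure \<Rightarrow> real set" where
  "Theta \<nu> = {t. theta_minus \<nu> < ereal t \<and> ereal t < theta_plus \<nu>}"

definition sym_radius :: "real set \<Rightarrow> ereal" where
  "sym_radius S = Sup {ereal \<alpha> | \<alpha>. {-\<alpha><..<\<alpha>} \<subseteq> S}"

text \<open>If the support of \<open>\<nu>\<close> has exactly \<open>N\<close> points, then \<open>T n\<close> vanishes
  \<open>\<nu>\<close>-almost everywhere for \<open>n \<ge> N\<close> and is not unique as a polynomial for \<open>n > N\<close>;
  hence a predicate rather than a function of \<open>\<nu>\<close>.\<close>
definition monic_orthogonal :: "real measure \<Rightarrow> (nat \<Rightarrow> real poly) \<Rightarrow> bool" where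
  "monic_orthogonal \<nu> T \<longleftrightarrow>
     (\<forall>n. degree (T n) = n \<and> lead_coeff (T n) = 1) \<and>
     (\<forall>n k. n \<noteq> k \<longrightarrow> (\<integral>x. poly (T n) x * poly (T k) x \<partial>\<nu>) = 0)"

text \<open>Elements of \<open>L\<^sup>2(\<nu>)\<close> are represented by functions; almost everywhere equality is not
  quotiented out.\<close>
definition L2_fun :: "real measure \<Rightarrow> (real \<Rightarrow> complex) set" where
  "L2_fun \<nu> = {f. f \<in> borel_measurable \<nu> \<and> integrable \<nu> (\<lambda>x. (cmod (f x))\<^sup>2)}"

definition L2_seminorm :: "real measure \<Rightarrow> (real \<Rightarrow> complex) \<Rightarrow> real" where
  "L2_seminorm \<nu> f = sqrt (\<integral>x. (cmod (f x))\<^sup>2 \<partial>\<nu>)"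

text \<open>Membership of the terms in \<open>L2_fun\<close> is required because the Bochner integral of a
  non-integrable function is \<open>0\<close>.\<close>
definition L2_summable :: "real measure \<Rightarrow> (nat \<Rightarrow> real \<Rightarrow> complex) \<Rightarrow> bool" where
  "L2_summable \<nu> f \<longleftrightarrow>
     (\<forall>n. f n \<in> L2_fun \<nu>) \<and>
     (\<exists>s \<in> L2_fun \<nu>. (\<lambda>N. L2_seminorm \<nu> (\<lambda>x. (\<Sum>n<N. f n x) - s x)) \<longlonglongrightarrow> 0)"

text \<open>The library's \<open>conv_radius\<close> needs coefficients in a Banach space type, which
  \<open>L\<^sup>2(\<nu>)\<close> is not; \<open>z\<close> ranges over the complex numbers.\<close>
definition L2_conv_radius :: "real measure \<Rightarrow> (nat \<Rightarrow> real \<Rightarrow> complex) \<Rightarrow> ereal" where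
  "L2_conv_radius \<nu> f =
     Sup {\<rho>. 0 \<le> \<rho> \<and>
             (\<forall>z. ereal (cmod z) < \<rho> \<longrightarrow> L2_summable \<nu> (\<lambda>n x. z ^ n * f n x))}"

end

(* Among monic polynomials of degree n, the orthogonal one has minimal L2 norm, so
   ||T_n|| <= ||x^n|| <= 1/r^n, since r |x| <= 1 on the support of the measure. Hence for |z| < r
   the norms of the terms z^n T_n are dominated by a geometric series, and L2 is complete. *)
theory Submission
  imports Defs
begin

section \<open>Support of the measure and the interval \<open>Theta\<close>\<close>

text \<open>The complement of the support is a union of open null sets; by the Lindelof property
  countably many of them already cover it.\<close>

lemma AE_msupp:
  assumes "sets \<nu> = sets borel"
  shows "AE x in \<nu>. x \<in> msupp \<nu>"
proof -
  define F where "F = {U::real set. open U \<and> emeasure \<nu> U = 0}"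
  obtain G where G: "G \<subseteq> F" "countable G" "\<Union>G = \<Union>F"
    using Lindelof[of F] F_def by blast
  have "\<Union>G \<in> null_sets \<nu>"
    using null_sets_UN'[OF G(2), of "\<lambda>U. U" \<nu>] G(1) assms by (force simp: F_def null_sets_def)
  moreover have "{x \<in> space \<nu>. x \<notin> msupp \<nu>} \<subseteq> \<Union>G"
    unfolding G(3) by (auto simp: F_def msupp_def zero_less_iff_neq_zero)
  ultimately show ?thesis by (rule AE_I')
qed

text \<open>A support point violating the bound would place the pole 1/x of the kernel 1/(1 -
  \<theta>x) inside \<open>Theta\<close>. But 1/x is at least \<open>theta_plus\<close> if x > 0 and
  at most \<open>theta_minus\<close> if x < 0.\<close>

lemma abs_mult_le_1_of_msupp:
  assumes K: "compact (msupp \<nu>)" and sub: "{-\<alpha><..<\<alpha>} \<subseteq> Theta \<nu>" and x: "x \<in> msupp \<nu>"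
  shows "\<alpha> * \<bar>x\<bar> \<le> 1"
proof (rule ccontr)
  assume "\<not> ?thesis"
  hence gt: "1 < \<alpha> * \<bar>x\<bar>" by simp
  hence x0: "x \<noteq> 0" by auto
  have "\<bar>1 / x\<bar> < \<alpha>" using gt x0 by (simp add: field_simps)
  hence "1 / x \<in> {-\<alpha><..<\<alpha>}" unfolding abs_less_iff greaterThanLessThan_iff by linarith
  hence "1 / x \<in> Theta \<nu>" using sub by blast
  hence t: "theta_minus \<nu> < ereal (1 / x)" "ereal (1 / x) < theta_plus \<nu>"
    by (auto simp: Theta_def)
  \<comment> \<open>Only for a bounded support are the real-valued \<open>Sup\<close> and
    \<open>Inf\<close> guaranteed to be bounds for its points.\<close>
  have bd: "bounded (msupp \<nu>)" using K by (rule compact_imp_bounded)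
  show False
  proof (cases "x > 0")
    case True
    have "x \<le> Sup (msupp \<nu>)" using x bd by (intro cSup_upper bounded_imp_bdd_above)
    hence "x \<le> upper_end \<nu>" by (simp add: upper_end_def)
    thus False using t(2) True by (simp add: theta_plus_def field_simps)
  next
    case False
    have "Inf (msupp \<nu>) \<le> x" using x bd by (intro cInf_lower bounded_imp_bdd_below)
    hence "lower_end \<nu> \<le> x" by (simp add: lower_end_def)
    thus False using t(1) False x0 by (simp add: theta_minus_def field_simps)
  qed
qed

section \<open>Orthogonal polynomials as minimizers of the norm\<close>

text \<open>Subtracting \<open>coeff q m\<close> times \<open>T m\<close> kills the top coefficient
  of \<open>q\<close>, and \<open>T m\<close> with m < n is itself orthogonal to \<open>T n\<close>.
  Vanishing coefficients, rather than a bound on \<open>degree\<close>, let the induction start at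
  the zero polynomial.\<close>

lemma monic_orthogonal_lower_degree:
  assumes T: "monic_orthogonal \<nu> T" and int: "\<And>p. integrable \<nu> (poly p)"
    and "m \<le> n" and "\<And>i. i \<ge> m \<Longrightarrow> coeff q i = 0"
  shows "(\<integral>x. poly (T n) x * poly q x \<partial>\<nu>) = 0"
  using assms(3,4)
proof (induction m arbitrary: q)
  case 0
  hence "q = 0" by (simp add: poly_eq_iff)
  thus ?case by simp
next
  case (Suc m)
  define q' where "q' = q - smult (coeff q m) (T m)"
  have deg: "degree (T m) = m" "coeff (T m) m = 1"
    using T unfolding monic_orthogonal_def by metis+
  have "coeff q' i = 0" if "i \<ge> m" for i
  proof (cases "i = m")
    case True
    thus ?thesis using deg by (simp add: q'_def)
  next
    case False
    thus ?thesis using that deg Suc.prems(2)[of i] by (simp add: q'_def coeff_eq_0)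
  qed
  hence IH: "(\<integral>x. poly (T n) x * poly q' x \<partial>\<nu>) = 0"
    using Suc.prems(1) by (intro Suc.IH) auto
  have int2: "integrable \<nu> (\<lambda>x. poly p x * poly r x)" for p r
    using int[of "p * r"] by (simp flip: poly_mult)
  have "(\<integral>x. poly (T n) x * poly q x \<partial>\<nu>) =
      (\<integral>x. poly (T n) x * poly q' x + coeff q m * (poly (T n) x * poly (T m) x) \<partial>\<nu>)"
    by (intro arg_cong[where f = "integral\<^sup>L \<nu>"]) (auto simp: q'_def algebra_simps)
  also have "\<dots> = (\<integral>x. poly (T n) x * poly q' x \<partial>\<nu>) +
      coeff q m * (\<integral>x. poly (T n) x * poly (T m) x \<partial>\<nu>)"
    using int2 by simp
  also have "\<dots> = 0"
    using IH T Suc.prems(1) by (simp add: monic_orthogonal_def)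
  finally show ?case .
qed

text \<open>Pythagoras: the leading terms of \<open>p\<close> and \<open>T n\<close> cancel, so
  \<open>q = p - T n\<close> is orthogonal to \<open>T n\<close>, and the squared norm of
  \<open>p\<close> is the sum of those of \<open>T n\<close> and \<open>q\<close>.\<close>

lemma monic_orthogonal_minimal:
  assumes T: "monic_orthogonal \<nu> T" and int: "\<And>p. integrable \<nu> (poly p)"
    and p: "degree p = n" "lead_coeff p = 1"
  shows "(\<integral>x. (poly (T n) x)\<^sup>2 \<partial>\<nu>) \<le> (\<integral>x. (poly p x)\<^sup>2 \<partial>\<nu>)"
proof -
  define q where "q = p - T n"
  have deg: "degree (T n) = n" "coeff (T n) n = 1"
    using T unfolding monic_orthogonal_def by metis+
  have "coeff q i = 0" if "i \<ge> n" for i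
    using that deg p by (cases "i = n") (auto simp: q_def coeff_eq_0)
  hence orth: "(\<integral>x. poly (T n) x * poly q x \<partial>\<nu>) = 0"
    by (intro monic_orthogonal_lower_degree[OF T int order_refl])
  have int2: "integrable \<nu> (\<lambda>x. poly p x * poly r x)" for p r
    using int[of "p * r"] by (simp flip: poly_mult)
  have sq: "integrable \<nu> (\<lambda>x. (poly p x)\<^sup>2)" for p
    using int[of "p\<^sup>2"] by (simp flip: poly_power)
  have "(\<integral>x. (poly p x)\<^sup>2 \<partial>\<nu>) =
      (\<integral>x. (poly (T n) x)\<^sup>2 + 2 * (poly (T n) x * poly q x) + (poly q x)\<^sup>2 \<partial>\<nu>)"
    by (intro arg_cong[where f = "integral\<^sup>L \<nu>"])
       (auto simp: q_def algebra_simps power2_eq_square)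
  also have "\<dots> = (\<integral>x. (poly (T n) x)\<^sup>2 \<partial>\<nu>) + (\<integral>x. (poly q x)\<^sup>2 \<partial>\<nu>)"
    using int2 sq orth by simp
  finally show ?thesis by simp
qed

section \<open>Convergence of dominated series in the space of square integrable functions\<close>

text \<open>Splitting each term as \<open>sqrt (c n)\<close> times
  \<open>cmod (f n) / sqrt (c n)\<close> reduces the bound to the finite Cauchy-Schwarz inequality,
  which passes to the limit. It serves as the pointwise estimate for tails of a series of
  functions.\<close>

lemma suminf_Cauchy_Schwarz_weighted:
  fixes f :: "nat \<Rightarrow> complex"
  assumes c: "\<And>n. c n > 0" "summable c" and h: "summable (\<lambda>n. (cmod (f n))\<^sup>2 / c n)"
  shows "summable (\<lambda>n. cmod (f n))"
    and "(cmod (suminf f))\<^sup>2 \<le> suminf c * (\<Sum>n. (cmod (f n))\<^sup>2 / c n)"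
proof -
  have "cmod (f n) \<le> c n + (cmod (f n))\<^sup>2 / c n" for n
  proof -
    have "cmod (f n) * c n \<le> (c n)\<^sup>2 + (cmod (f n))\<^sup>2"
      using sum_squares_bound[of "cmod (f n)" "c n"] mult_nonneg_nonneg[of "cmod (f n)" "c n"]
        norm_ge_zero[of "f n"] less_imp_le[OF c(1)[of n]] by linarith
    thus ?thesis using c(1)[of n] by (simp add: field_simps power2_eq_square)
  qed
  thus sum: "summable (\<lambda>n. cmod (f n))"
    by (intro summable_comparison_test'[OF summable_add[OF c(2) h], of 0]) auto
  have fin: "(cmod (\<Sum>n<N. f n))\<^sup>2 \<le> suminf c * (\<Sum>n. (cmod (f n))\<^sup>2 / c n)" for N
  proof -
    have "(cmod (\<Sum>n<N. f n))\<^sup>2 \<le> (\<Sum>n<N. cmod (f n))\<^sup>2"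
      by (intro power_mono norm_sum) auto
    also have "\<dots> = (\<Sum>n<N. sqrt (c n) * (cmod (f n) / sqrt (c n)))\<^sup>2"
      using c(1) by (intro arg_cong[where f = "\<lambda>x. x\<^sup>2"] sum.cong) (auto simp: less_imp_neq[symmetric])
    also have "\<dots> \<le> (\<Sum>n<N. (sqrt (c n))\<^sup>2) * (\<Sum>n<N. (cmod (f n) / sqrt (c n))\<^sup>2)"
      by (rule Cauchy_Schwarz_ineq_sum)
    also have "\<dots> = (\<Sum>n<N. c n) * (\<Sum>n<N. (cmod (f n))\<^sup>2 / c n)"
      using c(1) by (simp add: power_divide less_imp_le)
    also have "\<dots> \<le> suminf c * (\<Sum>n. (cmod (f n))\<^sup>2 / c n)"
      using c h by (intro mult_mono sum_le_suminf sum_nonneg suminf_nonneg) (auto simp: less_imp_le)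
    finally show ?thesis .
  qed
  have "(\<lambda>N. (cmod (\<Sum>n<N. f n))\<^sup>2) \<longlonglongrightarrow> (cmod (suminf f))\<^sup>2"
    by (intro tendsto_intros summable_LIMSEQ[OF summable_norm_cancel[OF sum]])
  thus "(cmod (suminf f))\<^sup>2 \<le> suminf c * (\<Sum>n. (cmod (f n))\<^sup>2 / c n)"
    by (rule LIMSEQ_le_const2) (simp add: fin)
qed

text \<open>Completeness of \<open>L\<^sup>2\<close> for dominated series: by Cauchy--Schwarz with weights \<open>c n\<close>, the square
  of the \<open>N\<close>-th tail is at most \<open>\<Sum>n. c (n + N)\<close> times the integrable function
  \<open>\<Sum>n. (cmod (f n x))\<^sup>2 / c n\<close>.\<close>
lemma L2_summable_dominated:
  assumes f: "\<And>n. f n \<in> L2_fun \<nu>" and c: "\<And>n. c n > 0" "summable c"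
    and le: "\<And>n. (\<integral>x. (cmod (f n x))\<^sup>2 \<partial>\<nu>) \<le> (c n)\<^sup>2"
  shows "L2_summable \<nu> f"
proof -
  \<comment> \<open>Dividing by \<open>c n\<close> once leaves an integral of at most
    \<open>c n\<close>, so the integrals of the \<open>g n\<close> are summable.\<close>
  define g where "g n x = (cmod (f n x))\<^sup>2 / c n" for n x
  have meas [measurable]: "f n \<in> borel_measurable \<nu>" for n
    using f by (simp add: L2_fun_def)
  have int: "integrable \<nu> (g n)" for n
    using f[of n] by (simp add: L2_fun_def g_def[abs_def])
  have g0: "g n x \<ge> 0" for n x using c(1)[of n] by (simp add: g_def)
  have gle: "(\<integral>x. g n x \<partial>\<nu>) \<le> c n" for n
    using le[of n] c(1)[of n] by (simp add: g_def field_simps power2_eq_square)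
  \<comment> \<open>Monotone convergence: the sum of the \<open>g n\<close> has finite integral,
    hence is finite almost everywhere.\<close>
  have "(\<integral>\<^sup>+x. (\<Sum>n. ennreal (g n x)) \<partial>\<nu>) = (\<Sum>n. ennreal (\<integral>x. g n x \<partial>\<nu>))"
    using int g0 by (subst nn_integral_suminf) (auto simp: nn_integral_eq_integral)
  also have "\<dots> \<le> (\<Sum>n. ennreal (c n))"
    by (intro suminf_le ennreal_leI gle) auto
  also have "\<dots> < \<infinity>"
    using c by (subst suminf_ennreal2) (auto simp: less_imp_le)
  finally have "AE x in \<nu>. (\<Sum>n. ennreal (g n x)) \<noteq> \<infinity>"
    using int by (intro nn_integral_noteq_infinite) auto
  hence ae: "AE x in \<nu>. summable (\<lambda>n. g n x)"
    using g0 by (auto elim!: eventually_mono intro!: summable_suminf_not_top)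
  have sumint: "summable (\<lambda>n. \<integral>x. norm (g n x) \<partial>\<nu>)"
  proof (rule summable_comparison_test'[OF c(2)])
    show "norm (\<integral>x. norm (g n x) \<partial>\<nu>) \<le> c n" for n
      using gle[of n] g0 Bochner_Integration.integral_nonneg[of \<nu> "g n"] by simp
  qed
  define h where "h x = (\<Sum>n. g n x)" for x
  have inth: "integrable \<nu> h"
    unfolding h_def using ae g0 by (intro integrable_suminf int sumint) auto
  \<comment> \<open>Where the series diverges, \<open>suminf\<close> yields a fixed unspecified
    value. This happens only on a null set, and \<open>tail\<close> is claimed only where the
    \<open>g n x\<close> are summable.\<close>
  define s where "s x = (\<Sum>n. f n x)" for x
  have [measurable]: "s \<in> borel_measurable \<nu>" unfolding s_def by measurable
  have [measurable]: "h \<in> borel_measurable \<nu>" using inth by simp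
  define t where "t N = (\<Sum>n. c (n + N))" for N
  have t0: "t N \<ge> 0" for N
    unfolding t_def using c by (intro suminf_nonneg) (auto simp: less_imp_le summable_iff_shift)
  have tail: "(cmod ((\<Sum>n<N. f n x) - s x))\<^sup>2 \<le> t N * h x" if "summable (\<lambda>n. g n x)" for N x
  proof -
    have "summable (\<lambda>n. cmod (f n x))"
      using suminf_Cauchy_Schwarz_weighted(1)[of c "\<lambda>n. f n x"] c that by (simp add: g_def)
    hence "summable (\<lambda>n. f n x)" by (rule summable_norm_cancel)
    hence "s x = (\<Sum>n. f (n + N) x) + (\<Sum>n<N. f n x)"
      unfolding s_def by (rule suminf_split_initial_segment)
    hence "(cmod ((\<Sum>n<N. f n x) - s x))\<^sup>2 = (cmod (\<Sum>n. f (n + N) x))\<^sup>2" by simp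
    also have "\<dots> \<le> t N * (\<Sum>n. g (n + N) x)"
      unfolding t_def g_def using c that summable_iff_shift[of "\<lambda>n. g n x" N]
      by (intro suminf_Cauchy_Schwarz_weighted(2)) (auto simp: summable_iff_shift g_def)
    also have "\<dots> \<le> t N * h x"
      unfolding h_def using t0[of N] suminf_split_initial_segment[OF that, of N] g0
      by (intro mult_left_mono) (auto simp: sum_nonneg)
    finally show ?thesis .
  qed
  have inttail: "integrable \<nu> (\<lambda>x. (cmod ((\<Sum>n<N. f n x) - s x))\<^sup>2)" for N
  proof (rule Bochner_Integration.integrable_bound)
    show "integrable \<nu> (\<lambda>x. t N * h x)" using inth by simp
    show "AE x in \<nu>. norm ((cmod ((\<Sum>n<N. f n x) - s x))\<^sup>2) \<le> norm (t N * h x)"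
      using ae
    proof (rule eventually_mono)
      fix x assume "summable (\<lambda>n. g n x)"
      from tail[OF this, of N]
      show "norm ((cmod ((\<Sum>n<N. f n x) - s x))\<^sup>2) \<le> norm (t N * h x)"
        unfolding real_norm_def abs_power2 by linarith
    qed
  qed measurable
  \<comment> \<open>For N = 0 the partial sum is empty, so the tail is \<open>s\<close> up to
    sign.\<close>
  have s: "s \<in> L2_fun \<nu>"
    using inttail[of 0] by (simp add: L2_fun_def)
  have "(\<lambda>N. L2_seminorm \<nu> (\<lambda>x. (\<Sum>n<N. f n x) - s x)) \<longlonglongrightarrow> 0"
  proof (rule tendsto_sandwich[OF always_eventually always_eventually tendsto_const])
    show "\<forall>N. 0 \<le> L2_seminorm \<nu> (\<lambda>x. (\<Sum>n<N. f n x) - s x)"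
      by (auto simp: L2_seminorm_def)
    show "\<forall>N. L2_seminorm \<nu> (\<lambda>x. (\<Sum>n<N. f n x) - s x) \<le> sqrt (t N * integral\<^sup>L \<nu> h)"
    proof
      fix N
      have "(\<integral>x. (cmod ((\<Sum>n<N. f n x) - s x))\<^sup>2 \<partial>\<nu>) \<le> (\<integral>x. t N * h x \<partial>\<nu>)"
        using ae inth inttail by (intro integral_mono_AE) (auto elim!: eventually_mono intro: tail)
      thus "L2_seminorm \<nu> (\<lambda>x. (\<Sum>n<N. f n x) - s x) \<le> sqrt (t N * integral\<^sup>L \<nu> h)"
        by (simp add: L2_seminorm_def)
    qed
    have "t \<longlonglongrightarrow> 0"
      unfolding t_def using c(2) by (rule suminf_exist_split2)
    hence "(\<lambda>N. sqrt (t N * integral\<^sup>L \<nu> h)) \<longlonglongrightarrow> sqrt (0 * integral\<^sup>L \<nu> h)"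
      by (intro tendsto_intros)
    thus "(\<lambda>N. sqrt (t N * integral\<^sup>L \<nu> h)) \<longlonglongrightarrow> 0" by simp
  qed
  with s f show ?thesis unfolding L2_summable_def by blast
qed

section \<open>Norm bounds and the power series of orthogonal polynomials\<close>

lemma integrable_poly_of_bounded:
  fixes \<nu> :: "real measure"
  assumes "finite_measure \<nu>" "sets \<nu> = sets borel" "AE x in \<nu>. \<bar>x\<bar> \<le> R"
  shows "integrable \<nu> (poly p)"
proof -
  interpret finite_measure \<nu> by fact
  note [measurable_cong] = assms(2)
  have "compact (poly p ` {-R..R})"
    by (intro compact_continuous_image continuous_intros) auto
  then obtain B where B: "\<And>x. x \<in> {-R..R} \<Longrightarrow> norm (poly p x) \<le> B"
    using compact_imp_bounded[of "poly p ` {-R..R}"] unfolding bounded_iff by blast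
  show ?thesis
  proof (rule integrable_const_bound)
    show "AE x in \<nu>. norm (poly p x) \<le> B"
      using assms(3) by (rule eventually_mono) (intro B, auto)
    have "continuous_on UNIV (poly p)" by (intro continuous_intros)
    hence "poly p \<in> borel_measurable borel" by (rule borel_measurable_continuous_onI)
    thus "poly p \<in> borel_measurable \<nu>" by simp
  qed
qed

text \<open>The competitor in the minimality property is \<open>monom 1 n\<close>; total mass 1
  turns its pointwise bound into a bound on the integral.\<close>

lemma monic_orthogonal_norm_le:
  fixes \<nu> :: "real measure"
  assumes "prob_space \<nu>" "sets \<nu> = sets borel" and ae: "AE x in \<nu>. \<bar>x\<bar> \<le> R"
    and T: "monic_orthogonal \<nu> T"
  shows "(\<integral>x. (poly (T n) x)\<^sup>2 \<partial>\<nu>) \<le> (R ^ n)\<^sup>2"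
proof -
  interpret prob_space \<nu> by fact
  have int: "integrable \<nu> (poly p)" for p
    by (rule integrable_poly_of_bounded[OF _ assms(2,3)]) unfold_locales
  have "(\<integral>x. (poly (T n) x)\<^sup>2 \<partial>\<nu>) \<le> (\<integral>x. (poly (monom 1 n) x)\<^sup>2 \<partial>\<nu>)"
    by (rule monic_orthogonal_minimal[OF T int]) (simp_all add: degree_monom_eq)
  also have "\<dots> \<le> (\<integral>x. (R ^ n)\<^sup>2 \<partial>\<nu>)"
  proof (rule integral_mono_AE)
    show "integrable \<nu> (\<lambda>x. (poly (monom 1 n) x)\<^sup>2)"
      using int[of "(monom 1 n)\<^sup>2"] by (simp flip: poly_power)
    show "AE x in \<nu>. (poly (monom 1 n) x)\<^sup>2 \<le> (R ^ n)\<^sup>2"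
      using ae
    proof (rule eventually_mono)
      fix x :: real assume "\<bar>x\<bar> \<le> R"
      hence "\<bar>x ^ n\<bar> \<le> R ^ n" by (simp add: power_abs power_mono)
      thus "(poly (monom 1 n) x)\<^sup>2 \<le> (R ^ n)\<^sup>2"
        by (simp add: poly_monom abs_le_square_iff[symmetric])
    qed
  qed simp
  finally show ?thesis by (simp add: prob_space)
qed

lemma L2_summable_monic_orthogonal:
  fixes \<nu> :: "real measure"
  assumes "prob_space \<nu>" "sets \<nu> = sets borel" and ae: "AE x in \<nu>. \<bar>x\<bar> \<le> R"
    and T: "monic_orthogonal \<nu> T" and z: "cmod z * R < 1"
  shows "L2_summable \<nu> (\<lambda>n x. z ^ n * complex_of_real (poly (T n) x))"
proof -
  interpret prob_space \<nu> by fact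
  \<comment> \<open>The weights \<rho>^n must be strictly positive, while \<open>cmod z * R\<close>
    may be 0; the maximum with 1/2 stays below 1.\<close>
  define \<rho> where "\<rho> = max (1 / 2) (cmod z * R)"
  have \<rho>: "0 < \<rho>" "\<rho> < 1" "cmod z * R \<le> \<rho>" using z by (auto simp: \<rho>_def)
  \<comment> \<open>A property holding almost everywhere for a probability measure holds at some
    point, which forces \<open>R\<close> to be nonnegative.\<close>
  have "\<exists>x. \<bar>x\<bar> \<le> R" using eventually_happens[OF ae] ae_filter_bot by blast
  hence R: "R \<ge> 0" by auto
  have int: "integrable \<nu> (poly p)" for p
    by (rule integrable_poly_of_bounded[OF _ assms(2,3)]) unfold_locales
  have sq: "(cmod (z ^ n * complex_of_real y))\<^sup>2 = (cmod z ^ n)\<^sup>2 * y\<^sup>2" for n y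
    by (simp add: norm_mult norm_power power_mult_distrib)
  show ?thesis
  proof (rule L2_summable_dominated)
    show "(\<lambda>x. z ^ n * complex_of_real (poly (T n) x)) \<in> L2_fun \<nu>" for n
    proof -
      have "integrable \<nu> (\<lambda>x. (poly (T n) x)\<^sup>2)"
        using int[of "(T n)\<^sup>2"] by (simp flip: poly_power)
      moreover have [measurable]: "poly (T n) \<in> borel_measurable \<nu>"
        using int by (rule borel_measurable_integrable)
      ultimately show ?thesis by (simp add: L2_fun_def sq)
    qed
    show "(\<integral>x. (cmod (z ^ n * complex_of_real (poly (T n) x)))\<^sup>2 \<partial>\<nu>) \<le> (\<rho> ^ n)\<^sup>2" for n
    proof -
      have "(\<integral>x. (cmod (z ^ n * complex_of_real (poly (T n) x)))\<^sup>2 \<partial>\<nu>) =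
          (cmod z ^ n)\<^sup>2 * (\<integral>x. (poly (T n) x)\<^sup>2 \<partial>\<nu>)"
        unfolding sq by simp
      also have "\<dots> \<le> (cmod z ^ n)\<^sup>2 * (R ^ n)\<^sup>2"
        using assms by (intro mult_left_mono monic_orthogonal_norm_le) auto
      also have "\<dots> = ((cmod z * R) ^ n)\<^sup>2" by (simp add: power_mult_distrib)
      also have "\<dots> \<le> (\<rho> ^ n)\<^sup>2"
        using \<rho> R by (intro power_mono) auto
      finally show ?thesis .
    qed
  qed (use \<rho> in \<open>auto intro: summable_geometric\<close>)
qed

theorem lemma2p2:
  fixes \<nu> :: "real measure" and T :: "nat \<Rightarrow> real poly"
  assumes "real_distribution \<nu>"
    and "compact (msupp \<nu>)"
    and "non_degenerate \<nu>"
    and "0 \<in> Theta \<nu>"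
    and "(\<integral>x. x \<partial>\<nu>) = 0"
    and "monic_orthogonal \<nu> T"
  shows "L2_conv_radius \<nu> (\<lambda>n x. complex_of_real (poly (T n) x)) \<ge> sym_radius (Theta \<nu>)"
proof -
  interpret real_distribution \<nu> by fact
  have sets: "sets \<nu> = sets borel" by simp
  show ?thesis
    unfolding sym_radius_def
  proof (rule Sup_least, clarify)
    fix \<alpha> :: real assume sub: "{-\<alpha><..<\<alpha>} \<subseteq> Theta \<nu>"
    \<comment> \<open>Negative \<alpha> also enter \<open>sym_radius\<close>, since the interval is
      then empty. The maximum with 0 makes the radius admissible in \<open>L2_conv_radius\<close>;
      for \<alpha> \<le> 0 no z satisfies the condition.\<close>
    have "L2_summable \<nu> (\<lambda>n x. z ^ n * complex_of_real (poly (T n) x))"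
      if "ereal (cmod z) < max 0 (ereal \<alpha>)" for z
    proof -
      have z: "cmod z < \<alpha>" "\<alpha> > 0"
        using that norm_ge_zero[of z] by (auto simp: max_def zero_ereal_def simp del: norm_ge_zero split: if_splits)
      \<comment> \<open>With \<open>R\<close> = 1/\<alpha>, the condition
        \<open>cmod z * R < 1\<close> becomes \<open>cmod z\<close> < \<alpha>.\<close>
      have "\<bar>x\<bar> \<le> 1 / \<alpha>" if "x \<in> msupp \<nu>" for x
        using abs_mult_le_1_of_msupp[OF assms(2) sub that] z by (simp add: field_simps)
      hence "AE x in \<nu>. \<bar>x\<bar> \<le> 1 / \<alpha>"
        using AE_msupp[OF sets] by (auto elim: eventually_mono)
      thus ?thesis
        using z by (intro L2_summable_monic_orthogonal prob_space_axioms sets assms(6)) auto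
    qed
    hence "max 0 (ereal \<alpha>) \<le> L2_conv_radius \<nu> (\<lambda>n x. complex_of_real (poly (T n) x))"
      unfolding L2_conv_radius_def by (intro Sup_upper) auto
    thus "ereal \<alpha> \<le> L2_conv_radius \<nu> (\<lambda>n x. complex_of_real (poly (T n) x))"
      by simp
  qed
qed

end
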